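(* Let $(C,M,P,\alpha)$ be the primitives of a multiclass queueing network and assume that $CMQ\Delta$ is invertible for every ratio matrix $\Delta$; write $R=R_\Delta=(CMQ\Delta)^{-1}$ and $\theta=\theta_\Delta=R_\Delta(\rho-e)$. Let $B$ be a large enough positive number (i.e., there is $B_0>0$ such that the following holds for every $B\ge B_0$). If $\rho<e$ (componentwise) and the min-max problem $$ \min_{\Delta\in\mathbb R_+^{K\times J}:\ CM\Delta=I}\ \ \max_{h,\ (\alpha^b)_b,\ \epsilon,\ (\eta^b)_b}\ \epsilon $$ subject to $$ h_a^\top\theta_a-(\alpha^b)^\top\theta_b\le-\epsilon\quad\forall (a,b),\qquad h_a^\top R_{ab}\le(\alpha^b)^\top R_b\quad\forall (a,b),\qquad \epsilon\, e^b\le R_b\eta^b\quad\forall\, \emptyset\ne b\subseteq\{1,\dots,J\}, $$ $$ \alpha^b\in\mathbb R^{|b|},\qquad h\in\mathbb R^J,\ h\ge e,\qquad \epsilon\le B,\qquad \eta^b\in\mathbb R^{|b|},\ \eta^b\ge e^b, $$ has a strictly positive optimal value, then the Skorohod problem is robustly queue-ratio stable, i.e., for every ratio matrix $\Delta$ the Skorohod problem with data $(R_\Delta,\theta_\Delta)$ is stable. Here $(a,b)$ ranges over the partitions of $\{1,\dots,J\}$ with $a\ne\emptyset$ ($b$ may be empty).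
   Context: Network primitives. There are $J$ stations and $K>J$ classes. $C$ is the $J\times K$ $0$–$1$ matrix with $C_{jk}=1$ iff class $k$ is served at station $j$ (each class is served at exactly one station, each station serves at least one class); $\mathcal C(j)$ is the set of classes served at station $j$. $M=\mathrm{diag}(m_1,\dots,m_K)$ with $m_k>0$. $P$ is a $K\times K$ nonnegative routing matrix with row sums at most $1$ and $I+P+P^2+\cdots$ convergent; $Q=(I-P')^{-1}$ (prime denotes transpose). $\alpha\in\mathbb R_+^K$ is the vector of exogenous arrival rates (unrelated to the decision variables $\alpha^b$), $\rho=CMQ\alpha\in\mathbb R^J$; $e$ is the all-ones vector and $e^b$ the all-ones vector in $\mathbb R^{|b|}$. A ratio matrix is a nonnegative $K\times J$ matrix $\Delta$ with $CM\Delta=I$ (this forces $\Delta_{kj}=0$ for $k\notin\mathcal C(j)$). $R_{ab}$ is the submatrix of $R$ with rows $a$ and columns $b$, $R_b=R_{bb}$, and $\theta_a$, $h_a$ are subvectors. Skorohod problem (SP) with data $(R,\theta)$: given $\bar W(0)\ge0$, a pair of continuous functions $(\bar Y,\bar W)$ is a solution if $\bar W(t)=\bar W(0)+\theta t+R\bar Y(t)\ge0$, $\bar Y(0)=0$, $\bar Y$ is nondecreasing, and $\int_0^\infty\bar W_j(t)\,d\bar Y_j(t)=0$ for all $j\in\{1,\dots,J\}$. It is stable if for every solution there is $T\in[0,\infty)$ with $\bar W(t)=0$ for all $t\ge T$. *)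

theory Defs
  imports "HOL-Analysis.Analysis"
begin

text \<open>
  Stations are the elements of the finite type \<open>'j\<close>, classes those of the finite type \<open>'k\<close>.
  On \<open>real ^ 'n ^ 'n\<close> the class operation \<open>^\<close> is entrywise, so matrix powers are
  iterated matrix products.
\<close>

definition mat_pow :: "real ^ 'n ^ 'n \<Rightarrow> nat \<Rightarrow> real ^ 'n ^ 'n" where
  "mat_pow A n = (((**) A) ^^ n) (mat 1)"

definition diag_mat :: "real ^ 'n \<Rightarrow> real ^ 'n ^ 'n" where
  "diag_mat v = (\<chi> i j. if i = j then v $ i else 0)"

definition network_primitives ::
    "real ^ 'k ^ 'j \<Rightarrow> real ^ 'k ^ 'k \<Rightarrow> real ^ 'k ^ 'k \<Rightarrow> real ^ 'k \<Rightarrow> bool" where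
  "network_primitives C M P \<alpha> \<longleftrightarrow>
     CARD('j) < CARD('k) \<and>
     (\<forall>j k. C $ j $ k \<in> {0, 1}) \<and>
     (\<forall>k. \<exists>!j. C $ j $ k = 1) \<and>
     (\<forall>j. \<exists>k. C $ j $ k = 1) \<and>
     (\<exists>m. (\<forall>k. 0 < m $ k) \<and> M = diag_mat m) \<and>
     (\<forall>k l. 0 \<le> P $ k $ l) \<and>
     (\<forall>k. (\<Sum>l\<in>UNIV. P $ k $ l) \<le> 1) \<and>
     summable (mat_pow P) \<and>
     (\<forall>k. 0 \<le> \<alpha> $ k)"

definition Q_mat :: "real ^ 'k ^ 'k \<Rightarrow> real ^ 'k ^ 'k" where
  "Q_mat P = matrix_inv (mat 1 - transpose P)"

definition load :: "real ^ 'k ^ 'j \<Rightarrow> real ^ 'k ^ 'k \<Rightarrow> real ^ 'k ^ 'k \<Rightarrow> real ^ 'k \<Rightarrow> real ^ 'j" where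
  "load C M P \<alpha> = (C ** M ** Q_mat P) *v \<alpha>"

definition ratio_matrix :: "real ^ 'k ^ 'j \<Rightarrow> real ^ 'k ^ 'k \<Rightarrow> real ^ 'j ^ 'k \<Rightarrow> bool" where
  "ratio_matrix C M \<Delta> \<longleftrightarrow> (\<forall>k j. 0 \<le> \<Delta> $ k $ j) \<and> C ** M ** \<Delta> = mat 1"

definition R_mat ::
    "real ^ 'k ^ 'j \<Rightarrow> real ^ 'k ^ 'k \<Rightarrow> real ^ 'k ^ 'k \<Rightarrow> real ^ 'j ^ 'k \<Rightarrow> real ^ 'j ^ 'j" where
  "R_mat C M P \<Delta> = matrix_inv (C ** M ** Q_mat P ** \<Delta>)"

definition theta_vec ::
    "real ^ 'k ^ 'j \<Rightarrow> real ^ 'k ^ 'k \<Rightarrow> real ^ 'k ^ 'k \<Rightarrow> real ^ 'k \<Rightarrow> real ^ 'j ^ 'k \<Rightarrow> real ^ 'j" where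
  "theta_vec C M P \<alpha> \<Delta> = R_mat C M P \<Delta> *v (load C M P \<alpha> - (\<chi> j. 1))"

text \<open>
  Paths live on \<open>{0..}\<close> and their values at negative times are irrelevant.
  The integral of \<open>W\<^sub>j\<close> against \<open>dY\<^sub>j\<close> is the Lebesgue-Stieltjes integral over \<open>{0..}\<close>;
  extending \<open>Y\<^sub>j\<close> by the constant \<open>Y\<^sub>j 0\<close> to the left of \<open>0\<close> makes the integrator monotone
  and continuous on the whole line, as \<open>interval_measure\<close> requires.
  As \<open>W\<close> is nonnegative, the nonnegative integral is the integral.
\<close>

definition skorohod_solution ::
    "real ^ 'j ^ 'j \<Rightarrow> real ^ 'j \<Rightarrow> (real \<Rightarrow> real ^ 'j) \<Rightarrow> (real \<Rightarrow> real ^ 'j) \<Rightarrow> bool" where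
  "skorohod_solution R \<theta> Y W \<longleftrightarrow>
     continuous_on {0..} Y \<and> continuous_on {0..} W \<and>
     (\<forall>t\<ge>0. W t = W 0 + t *\<^sub>R \<theta> + R *v Y t) \<and>
     (\<forall>t\<ge>0. \<forall>j. 0 \<le> W t $ j) \<and>
     Y 0 = 0 \<and>
     (\<forall>s t. 0 \<le> s \<and> s \<le> t \<longrightarrow> (\<forall>j. Y s $ j \<le> Y t $ j)) \<and>
     (\<forall>j. (\<integral>\<^sup>+t\<in>{0..}. ennreal (W t $ j) \<partial>interval_measure (\<lambda>t. Y (max 0 t) $ j)) = 0)"

definition skorohod_stable :: "real ^ 'j ^ 'j \<Rightarrow> real ^ 'j \<Rightarrow> bool" where
  "skorohod_stable R \<theta> \<longleftrightarrow>
     (\<forall>Y W. skorohod_solution R \<theta> Y W \<longrightarrow> (\<exists>T\<ge>0. \<forall>t\<ge>T. W t = 0))"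

definition robustly_queue_ratio_stable ::
    "real ^ 'k ^ 'j \<Rightarrow> real ^ 'k ^ 'k \<Rightarrow> real ^ 'k ^ 'k \<Rightarrow> real ^ 'k \<Rightarrow> bool" where
  "robustly_queue_ratio_stable C M P \<alpha> \<longleftrightarrow>
     (\<forall>\<Delta>. ratio_matrix C M \<Delta> \<longrightarrow> skorohod_stable (R_mat C M P \<Delta>) (theta_vec C M P \<alpha> \<Delta>))"

text \<open>
  The families \<open>\<alpha>\<^sup>b\<close> and \<open>\<eta>\<^sup>b\<close> are functions \<open>a\<close> and \<open>\<eta>\<close> of the index set \<open>b\<close>, with
  values in \<open>real ^ 'j\<close> of which only the coordinates in \<open>b\<close> are constrained or used.
  The block \<open>A\<close>, \<open>b\<close> of \<open>R\<close> appears through sums over \<open>A\<close> and \<open>b\<close>.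
\<close>

definition inner_feasible ::
    "real ^ 'j ^ 'j \<Rightarrow> real ^ 'j \<Rightarrow> real \<Rightarrow>
     real ^ 'j \<Rightarrow> ('j set \<Rightarrow> real ^ 'j) \<Rightarrow> real \<Rightarrow> ('j set \<Rightarrow> real ^ 'j) \<Rightarrow> bool" where
  "inner_feasible R \<theta> B h a \<epsilon> \<eta> \<longleftrightarrow>
     (\<forall>A b. A \<union> b = UNIV \<and> A \<inter> b = {} \<and> A \<noteq> {} \<longrightarrow>
        (\<Sum>i\<in>A. h $ i * \<theta> $ i) - (\<Sum>i\<in>b. a b $ i * \<theta> $ i) \<le> - \<epsilon> \<and>
        (\<forall>l\<in>b. (\<Sum>i\<in>A. h $ i * R $ i $ l) \<le> (\<Sum>i\<in>b. a b $ i * R $ i $ l))) \<and>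
     (\<forall>b. b \<noteq> {} \<longrightarrow>
        (\<forall>i\<in>b. \<epsilon> \<le> (\<Sum>l\<in>b. R $ i $ l * \<eta> b $ l)) \<and> (\<forall>l\<in>b. 1 \<le> \<eta> b $ l)) \<and>
     (\<forall>i. 1 \<le> h $ i) \<and>
     \<epsilon> \<le> B"

text \<open>
  Optimal values are taken in the extended reals as supremum and infimum, with value
  \<open>-\<infinity>\<close> for an infeasible inner problem.
\<close>

definition inner_value :: "real ^ 'j ^ 'j \<Rightarrow> real ^ 'j \<Rightarrow> real \<Rightarrow> ereal" where
  "inner_value R \<theta> B = Sup {ereal \<epsilon> | h a \<epsilon> \<eta>. inner_feasible R \<theta> B h a \<epsilon> \<eta>}"

definition minmax_value ::
    "real ^ 'k ^ 'j \<Rightarrow> real ^ 'k ^ 'k \<Rightarrow> real ^ 'k ^ 'k \<Rightarrow> real ^ 'k \<Rightarrow> real \<Rightarrow> ereal" where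
  "minmax_value C M P \<alpha> B =
     (INF \<Delta>\<in>{\<Delta>. ratio_matrix C M \<Delta>}.
        inner_value (R_mat C M P \<Delta>) (theta_vec C M P \<alpha> \<Delta>) B)"

end

theory Submission
  imports Defs
begin

text \<open>
  Along a solution \<open>W\<close> the linear function \<open>h \<bullet> W\<close> decreases at rate at least \<open>\<epsilon>\<close> as long as
  \<open>W \<noteq> 0\<close>. Usually one differentiates at a regular time; here differentiability is replaced by
  an induction on the set \<open>b\<close> of coordinates that are allowed to vanish. Between two times at
  which all of \<open>W\<^sub>b\<close> is zero while \<open>W\<close> stays positive off \<open>b\<close>, the increments satisfy
  \<open>0 = \<theta>\<^sub>b \<Delta>t + R\<^sub>b \<Delta>Y\<^sub>b\<close>, and the constraints for the partition \<open>(- b, b)\<close> give the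
  estimate at once. On the remaining time intervals some coordinate in \<open>b\<close> is locally positive,
  so the induction hypothesis for a smaller set applies.
\<close>

section \<open>Complementarity: a regulator is constant while its coordinate is positive\<close>

lemma interval_measure_zero_imp_constant:
  fixes F f :: "real \<Rightarrow> real"
  assumes contf: "continuous_on {0..} f"
    and contF: "continuous_on {0..} F"
    and monoF: "\<And>s t. 0 \<le> s \<Longrightarrow> s \<le> t \<Longrightarrow> F s \<le> F t"
    and zero: "(\<integral>\<^sup>+t\<in>{0..}. ennreal (f t) \<partial>interval_measure (\<lambda>t. F (max 0 t))) = 0"
    and "0 \<le> s" "s \<le> t" and pos: "\<And>u. u \<in> {s..t} \<Longrightarrow> 0 < f u"
  shows "F t = F s"
proof -
  let ?G = "\<lambda>t. F (max 0 t)"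
  have "continuous_on {s..t} f"
    using contf by (rule continuous_on_subset) (use \<open>0 \<le> s\<close> in auto)
  then obtain x where x: "x \<in> {s..t}" "\<And>y. y \<in> {s..t} \<Longrightarrow> f x \<le> f y"
    using continuous_attains_inf[of "{s..t}" f] \<open>s \<le> t\<close> by auto
  have "continuous_on UNIV ?G"
    by (rule continuous_on_compose2[OF contF]) (auto intro!: continuous_intros)
  then have cG: "continuous (at_right a) ?G" for a
    by (meson UNIV_I continuous_on_eq_continuous_within continuous_within_subset subset_UNIV)
  have "emeasure (interval_measure ?G) {s<..t} = ennreal (?G t - ?G s)"
    by (rule emeasure_interval_measure_Ioc) (use \<open>s \<le> t\<close> cG in \<open>auto intro!: monoF\<close>)
  then have m: "emeasure (interval_measure ?G) {s<..t} = ennreal (F t - F s)"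
    using \<open>0 \<le> s\<close> \<open>s \<le> t\<close> by (simp add: max_def)
  \<comment> \<open>The positive minimum \<open>f x\<close> times the growth of \<open>F\<close>
    bounds the vanishing integral from below, so the growth is zero.\<close>
  have "ennreal (f x) * ennreal (F t - F s)
      = (\<integral>\<^sup>+u. ennreal (f x) * indicator {s<..t} u \<partial>interval_measure ?G)"
    by (subst nn_integral_cmult_indicator) (auto simp: m)
  also have "\<dots> \<le> (\<integral>\<^sup>+u\<in>{0..}. ennreal (f u) \<partial>interval_measure ?G)"
    by (rule nn_integral_mono)
      (use x(2) \<open>0 \<le> s\<close> in \<open>auto simp: indicator_def intro!: ennreal_leI\<close>)
  finally have "ennreal (f x) * ennreal (F t - F s) = 0"
    using zero by simp
  with pos[OF x(1)] monoF[OF \<open>0 \<le> s\<close> \<open>s \<le> t\<close>] show ?thesis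
    by (auto simp: ennreal_eq_0_iff)
qed

section \<open>Increments along a fixed solution\<close>

context
  fixes R :: "real ^ 'j ^ 'j" and \<theta> :: "real ^ 'j" and Y W :: "real \<Rightarrow> real ^ 'j"
    and h :: "real ^ 'j" and a :: "'j set \<Rightarrow> real ^ 'j" and \<epsilon> :: real
  assumes sol: "skorohod_solution R \<theta> Y W"
    and drift: "\<And>b. b \<noteq> UNIV \<Longrightarrow>
      (\<Sum>i\<in>-b. h $ i * \<theta> $ i) - (\<Sum>i\<in>b. a b $ i * \<theta> $ i) \<le> - \<epsilon>"
    and reflection: "\<And>b l. b \<noteq> UNIV \<Longrightarrow> l \<in> b \<Longrightarrow>
      (\<Sum>i\<in>-b. h $ i * R $ i $ l) \<le> (\<Sum>i\<in>b. a b $ i * R $ i $ l)"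
begin

lemma solution_continuous: "continuous_on {0..} Y" "continuous_on {0..} W"
  and solution_W: "0 \<le> t \<Longrightarrow> W t = W 0 + t *\<^sub>R \<theta> + R *v Y t"
  and W_nonneg: "0 \<le> t \<Longrightarrow> 0 \<le> W t $ i"
  and Y_mono: "0 \<le> s \<Longrightarrow> s \<le> t \<Longrightarrow> Y s $ i \<le> Y t $ i"
  and solution_complementary:
    "(\<integral>\<^sup>+t\<in>{0..}. ennreal (W t $ i) \<partial>interval_measure (\<lambda>t. Y (max 0 t) $ i)) = 0"
  using sol unfolding skorohod_solution_def by blast+

lemma continuous_on_W: "0 \<le> s \<Longrightarrow> continuous_on {s..t} W"
  by (rule continuous_on_subset[OF solution_continuous(2)]) auto

lemma Y_constant:
  assumes "0 \<le> s" "s \<le> t" "\<And>u. u \<in> {s..t} \<Longrightarrow> 0 < W u $ i"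
  shows "Y t $ i = Y s $ i"
  by (rule interval_measure_zero_imp_constant[where f = "\<lambda>u. W u $ i" and F = "\<lambda>u. Y u $ i"])
    (use assms in \<open>auto intro!: continuous_intros solution_continuous Y_mono solution_complementary\<close>)

lemma W_increment:
  assumes "0 \<le> s" "s \<le> t"
  shows "W t $ i - W s $ i = (t - s) * \<theta> $ i + (\<Sum>l\<in>UNIV. R $ i $ l * (Y t $ l - Y s $ l))"
proof -
  have "W t - W s = (t - s) *\<^sub>R \<theta> + R *v (Y t - Y s)"
    using solution_W[of s] solution_W[of t] assms
    by (simp add: scaleR_diff_left matrix_vector_mult_diff_distrib)
  then have "(W t - W s) $ i = ((t - s) *\<^sub>R \<theta> + R *v (Y t - Y s)) $ i"
    by simp
  then show ?thesis
    by (simp add: matrix_vector_mult_def)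
qed

section \<open>Linear decrease of \<open>h \<bullet> W\<close> away from the origin\<close>

definition decay :: "real \<Rightarrow> real \<Rightarrow> bool" where
  "decay s t \<longleftrightarrow> h \<bullet> W t + \<epsilon> * t \<le> h \<bullet> W s + \<epsilon> * s"

text \<open>Comparing only endpoint values lets estimates on adjacent intervals be chained; this
  takes the place of integrating a derivative.\<close>

lemma decay_trans: "decay r s \<Longrightarrow> decay s t \<Longrightarrow> decay r t"
  unfolding decay_def by linarith

lemma continuous_on_decay: "0 \<le> s \<Longrightarrow> continuous_on {s..t} (\<lambda>u. h \<bullet> W u + \<epsilon> * u)"
  by (intro continuous_intros continuous_on_W)

text \<open>Continuity carries the estimate to an endpoint at which the hypotheses used before it
  break down, such as the first time at which \<open>W\<close> vanishes on \<open>b\<close>.\<close>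

lemma decay_limit_right:
  assumes "0 \<le> s" "s \<le> t" "\<And>u. s \<le> u \<Longrightarrow> u < t \<Longrightarrow> decay s u"
  shows "decay s t"
proof (cases "s = t")
  case False
  with assms have "s < t" by simp
  then show ?thesis
    unfolding decay_def
    by (intro continuous_le_on_closure[of "{s..<t}" "\<lambda>u. h \<bullet> W u + \<epsilon> * u" t])
      (use assms continuous_on_decay[of s t] in \<open>auto simp: decay_def\<close>)
qed (simp add: decay_def)

lemma decay_limit_left:
  assumes "0 \<le> s" "s \<le> t" "\<And>u. s < u \<Longrightarrow> u \<le> t \<Longrightarrow> decay u t"
  shows "decay s t"
proof (cases "s = t")
  case False
  with assms have "s < t" by simp
  then show ?thesis
    unfolding decay_def
    by (intro continuous_ge_on_closure[of "{s<..t}" "\<lambda>u. h \<bullet> W u + \<epsilon> * u" s])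
      (use assms continuous_on_decay[of s t] in \<open>auto simp: decay_def\<close>)
qed (simp add: decay_def)

text \<open>Inside the interval the coordinates in \<open>b\<close> may move freely, since only
  total increments enter. Outside \<open>b\<close> the regulator does not grow. The vector
  \<open>a b\<close> acts as a multiplier that trades the rows \<open>-b\<close> of \<open>R\<close>
  for the rows \<open>b\<close>, where the reflection term is known to cancel the drift.\<close>

lemma decay_between_zeros:
  assumes st: "0 \<le> s" "s \<le> t" and b: "b \<noteq> UNIV"
    and pos: "\<And>u i. u \<in> {s..t} \<Longrightarrow> i \<notin> b \<Longrightarrow> 0 < W u $ i"
    and zero: "\<And>i. i \<in> b \<Longrightarrow> W s $ i = 0" "\<And>i. i \<in> b \<Longrightarrow> W t $ i = 0"
  shows "decay s t"
proof -
  define y where "y l = Y t $ l - Y s $ l" for l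
  have y_nonneg: "0 \<le> y l" for l
    using Y_mono[OF st] by (simp add: y_def)
  have y0: "y l = 0" if "l \<notin> b" for l
    using Y_constant[OF st, of l] pos that unfolding y_def by auto
  have incr: "W t $ i - W s $ i = (t - s) * \<theta> $ i + (\<Sum>l\<in>b. R $ i $ l * y l)" for i
  proof -
    have "(\<Sum>l\<in>UNIV. R $ i $ l * y l) = (\<Sum>l\<in>b. R $ i $ l * y l)"
      by (rule sum.mono_neutral_right) (auto simp: y0)
    then show ?thesis using W_increment[OF st, of i] by (simp add: y_def)
  qed
  have Rb: "(\<Sum>l\<in>b. R $ i $ l * y l) = - ((t - s) * \<theta> $ i)" if "i \<in> b" for i
    using incr[of i] zero that by simp
  have "h \<bullet> W t - h \<bullet> W s = (\<Sum>i\<in>UNIV. h $ i * (W t $ i - W s $ i))"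
    by (simp add: inner_vec_def sum_subtractf right_diff_distrib)
  also have "\<dots> = (\<Sum>i\<in>-b. h $ i * (W t $ i - W s $ i))"
    by (rule sum.mono_neutral_right) (auto simp: zero)
  also have "\<dots> = (t - s) * (\<Sum>i\<in>-b. h $ i * \<theta> $ i) + (\<Sum>i\<in>-b. \<Sum>l\<in>b. h $ i * R $ i $ l * y l)"
    by (simp add: incr distrib_left sum.distrib sum_distrib_left mult_ac)
  also have "(\<Sum>i\<in>-b. \<Sum>l\<in>b. h $ i * R $ i $ l * y l) = (\<Sum>l\<in>b. (\<Sum>i\<in>-b. h $ i * R $ i $ l) * y l)"
    by (subst sum.swap) (simp add: sum_distrib_right)
  \<comment> \<open>The regulator increments are nonnegative, so the reflection constraints can be
    summed with the weights \<open>y l\<close>.\<close>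
  also have "\<dots> \<le> (\<Sum>l\<in>b. (\<Sum>i\<in>b. a b $ i * R $ i $ l) * y l)"
    by (intro sum_mono mult_right_mono reflection b y_nonneg)
  also have "\<dots> = (\<Sum>i\<in>b. a b $ i * (\<Sum>l\<in>b. R $ i $ l * y l))"
    unfolding sum_distrib_left sum_distrib_right by (subst sum.swap) (simp add: mult_ac)
  also have "\<dots> = - ((t - s) * (\<Sum>i\<in>b. a b $ i * \<theta> $ i))"
  proof -
    have "a b $ i * (\<Sum>l\<in>b. R $ i $ l * y l) = - ((t - s) * (a b $ i * \<theta> $ i))" if "i \<in> b" for i
      by (simp add: Rb[OF that])
    then show ?thesis by (simp add: sum_negf sum_distrib_left)
  qed
  finally have "h \<bullet> W t - h \<bullet> W s
      \<le> (t - s) * ((\<Sum>i\<in>-b. h $ i * \<theta> $ i) - (\<Sum>i\<in>b. a b $ i * \<theta> $ i))"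
    by (simp add: right_diff_distrib)
  also have "\<dots> \<le> (t - s) * - \<epsilon>"
    using drift[OF b] st by (intro mult_left_mono) auto
  finally show ?thesis
    unfolding decay_def by (simp add: algebra_simps)
qed

text \<open>Around each time some coordinate \<open>j\<close> in \<open>b\<close> stays positive, so
  \<open>smaller\<close> gives the estimate on every short interval there; bisection and
  transitivity extend it to the whole interval.\<close>

lemma decay_local:
  assumes smaller: "\<And>j s t. j \<in> b \<Longrightarrow> 0 \<le> s \<Longrightarrow> s \<le> t \<Longrightarrow>
      (\<And>u i. u \<in> {s..t} \<Longrightarrow> i \<notin> b - {j} \<Longrightarrow> 0 < W u $ i) \<Longrightarrow> decay s t"
    and st: "0 \<le> s" "s \<le> t"
    and pos: "\<And>u i. u \<in> {s..t} \<Longrightarrow> i \<notin> b \<Longrightarrow> 0 < W u $ i"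
    and nonzero: "\<And>u. u \<in> {s..t} \<Longrightarrow> \<exists>j\<in>b. W u $ j \<noteq> 0"
  shows "decay s t"
proof -
  have "s \<le> s \<and> t \<le> t \<longrightarrow> decay s t"
  \<comment> \<open>The guard is needed because the local condition also ranges over intervals that
    reach beyond \<open>{s..t}\<close>, where positivity is not known.\<close>
  proof (rule Bolzano[OF \<open>s \<le> t\<close>, of "\<lambda>p q. s \<le> p \<and> q \<le> t \<longrightarrow> decay p q"])
    fix x assume x: "s \<le> x" "x \<le> t"
    then obtain j where j: "j \<in> b" "W x $ j \<noteq> 0" using nonzero[of x] by auto
    with W_nonneg[of x j] x st have Wx: "0 < W x $ j" by auto
    have "continuous_on {s..t} (\<lambda>u. W u $ j)"
      using continuous_on_W[OF \<open>0 \<le> s\<close>] by (intro continuous_intros)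
    \<comment> \<open>Taking the value \<open>W x $ j\<close> itself as tolerance keeps
      \<open>W u $ j\<close> positive.\<close>
    then obtain d where d: "d > 0"
      "\<And>u. u \<in> {s..t} \<Longrightarrow> dist u x < d \<Longrightarrow> dist (W u $ j) (W x $ j) < W x $ j"
      using x Wx unfolding continuous_on_iff by fastforce
    have "decay p q" if pq: "p \<le> x" "x \<le> q" "q - p < d" "s \<le> p" "q \<le> t" for p q
    proof (rule smaller[OF \<open>j \<in> b\<close>])
      fix u i assume u: "u \<in> {p..q}" and i: "i \<notin> b - {j}"
      show "0 < W u $ i"
      proof (cases "i = j")
        case True
        have "dist u x < d" using u pq by (auto simp: dist_real_def)
        then show ?thesis using d(2)[of u] u pq True by (auto simp: dist_real_def)
      qed (use pos u i pq in auto)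
    qed (use pq st in auto)
    then show "\<exists>d>0. \<forall>p q. p \<le> x \<and> x \<le> q \<and> q - p < d \<longrightarrow> s \<le> p \<and> q \<le> t \<longrightarrow> decay p q"
      using d(1) by blast
  qed (auto intro: decay_trans)
  then show ?thesis by simp
qed

lemma compact_zeros: "0 \<le> s \<Longrightarrow> compact {u \<in> {s..t}. \<forall>i\<in>b. W u $ i = 0}"
proof -
  assume "0 \<le> s"
  \<comment> \<open>The outer \<open>{s..t}\<close> matters for empty \<open>b\<close>, where the
    inner intersection is the whole line.\<close>
  have "closed ({s..t} \<inter> (\<Inter>i\<in>b. {u \<in> {s..t}. W u $ i = 0}))"
    using continuous_on_W[OF \<open>0 \<le> s\<close>]
    by (intro closed_Int closed_INT ballI continuous_closed_preimage_constant continuous_intros) auto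
  also have "{s..t} \<inter> (\<Inter>i\<in>b. {u \<in> {s..t}. W u $ i = 0}) = {u \<in> {s..t}. \<forall>i\<in>b. W u $ i = 0}"
    by auto
  finally show ?thesis
    by (auto simp: compact_eq_bounded_closed intro: bounded_subset[of "{s..t}"])
qed

text \<open>The interval is cut at the first and the last time at which \<open>W\<close> vanishes on
  \<open>b\<close>. For empty \<open>b\<close> these are \<open>s\<close> and \<open>t\<close>, so
  the induction needs no separate base case.\<close>

lemma decay_positive_off:
  assumes "b \<noteq> UNIV" "0 \<le> s" "s \<le> t"
    and "\<And>u i. u \<in> {s..t} \<Longrightarrow> i \<notin> b \<Longrightarrow> 0 < W u $ i"
  shows "decay s t"
  using finite[of b] assms
proof (induction b arbitrary: s t rule: finite_psubset_induct)
  case (psubset b)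
  note pos = psubset.prems(4)
  define Z where "Z = {u \<in> {s..t}. \<forall>i\<in>b. W u $ i = 0}"
  have smaller: "decay p q"
    if "j \<in> b" "0 \<le> p" "p \<le> q" "\<And>u i. u \<in> {p..q} \<Longrightarrow> i \<notin> b - {j} \<Longrightarrow> 0 < W u $ i" for j p q
    by (rule psubset.IH[of "b - {j}"]) (use that in auto)
  have off_Z: "decay p q" if "s \<le> p" "p \<le> q" "q \<le> t" "{p..q} \<inter> Z = {}" for p q
    by (rule decay_local[OF smaller]) (use that psubset.prems in \<open>auto simp: Z_def\<close>)
  show ?case
  proof (cases "Z = {}")
    case True
    then show ?thesis using off_Z[of s t] psubset.prems by auto
  next
    case False
    have "compact Z" unfolding Z_def by (rule compact_zeros) fact
    then obtain p q where pq: "p \<in> Z" "\<And>u. u \<in> Z \<Longrightarrow> p \<le> u" "q \<in> Z" "\<And>u. u \<in> Z \<Longrightarrow> u \<le> q"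
      using compact_attains_inf compact_attains_sup False by metis
    then have "s \<le> p" "p \<le> q" "q \<le> t" by (auto simp: Z_def)
    have "decay s p"
    proof (rule decay_limit_right)
      fix u assume u: "s \<le> u" "u < p"
      then have "{s..u} \<inter> Z = {}" using pq(2) by fastforce
      with u \<open>p \<le> q\<close> \<open>q \<le> t\<close> show "decay s u" by (intro off_Z) auto
    qed fact+
    moreover have "decay p q"
      using \<open>s \<le> p\<close> \<open>p \<le> q\<close> \<open>q \<le> t\<close> psubset.prems pq
      by (intro decay_between_zeros[of p q b]) (auto simp: Z_def)
    moreover have "decay q t"
    proof (rule decay_limit_left)
      show "0 \<le> q" using \<open>0 \<le> s\<close> \<open>s \<le> p\<close> \<open>p \<le> q\<close> by linarith
      fix u assume u: "q < u" "u \<le> t"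
      then have "{u..t} \<inter> Z = {}" using pq(4) by fastforce
      with u \<open>s \<le> p\<close> \<open>p \<le> q\<close> show "decay u t" by (intro off_Z) auto
    qed fact
    ultimately show ?thesis by (blast intro: decay_trans)
  qed
qed

text \<open>No constraint belongs to \<open>b = UNIV\<close>, but at each time with
  \<open>W u \<noteq> 0\<close> some coordinate is positive, which reduces locally to the sets
  \<open>UNIV - {j}\<close>.\<close>

lemma decay_nonzero:
  assumes "0 \<le> s" "s \<le> t" and "\<And>u. u \<in> {s..t} \<Longrightarrow> W u \<noteq> 0"
  shows "decay s t"
proof (rule decay_local[of UNIV])
  show "decay p q"
    if "0 \<le> p" "p \<le> q" "\<And>u i. u \<in> {p..q} \<Longrightarrow> i \<notin> UNIV - {j} \<Longrightarrow> 0 < W u $ i" for j p q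
    by (rule decay_positive_off[of "UNIV - {j}"]) (use that in auto)
qed (use assms in \<open>auto simp: vec_eq_iff\<close>)

section \<open>Hitting the origin and staying there\<close>

lemma eventually_zero:
  assumes h: "\<And>i. 0 < h $ i" and "0 < \<epsilon>"
  shows "\<exists>T\<ge>0. \<forall>t\<ge>T. W t = 0"
proof -
  have V_nonneg: "0 \<le> h \<bullet> W t" if "0 \<le> t" for t
    unfolding inner_vec_def inner_real_def
    by (intro sum_nonneg mult_nonneg_nonneg W_nonneg that less_imp_le[OF h])
  have V_zero: "W t = 0" if "0 \<le> t" "h \<bullet> W t \<le> 0" for t
  proof -
    have "(\<Sum>i\<in>UNIV. h $ i * W t $ i) = 0"
      using V_nonneg[OF that(1)] that(2) by (simp add: inner_vec_def)
    moreover have "0 \<le> h $ i * W t $ i" for i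
      by (intro mult_nonneg_nonneg W_nonneg that less_imp_le[OF h])
    ultimately have "h $ i * W t $ i = 0" for i
      by (simp add: sum_nonneg_eq_0_iff)
    with h show ?thesis by (metis mult_eq_0_iff order_less_irrefl vec_eq_iff zero_index)
  qed
  \<comment> \<open>If \<open>W\<close> avoided the origin up to time \<open>S\<close>, the decay
    would force \<open>h \<bullet> W S \<le> -\<epsilon>\<close>; the summand 1 makes this bound
    strictly negative.\<close>
  define S where "S = h \<bullet> W 0 / \<epsilon> + 1"
  have S: "0 \<le> S" "\<epsilon> * S = h \<bullet> W 0 + \<epsilon>"
    using \<open>0 < \<epsilon>\<close> V_nonneg[of 0] by (auto simp: S_def field_simps)
  obtain z where z: "0 \<le> z" "W z = 0"
  proof (rule ccontr)
    assume "\<not> thesis"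
    with that have "W u \<noteq> 0" if "0 \<le> u" for u using \<open>0 \<le> u\<close> by blast
    then have "decay 0 S" using S by (intro decay_nonzero) auto
    with V_nonneg[OF S(1)] S \<open>0 < \<epsilon>\<close> show False by (simp add: decay_def)
  qed
  have "W t = 0" if "z \<le> t" for t
  proof -
    \<comment> \<open>After the last zero \<open>q\<close> up to time \<open>t\<close>, the function
      \<open>h \<bullet> W\<close> can only decrease from 0, hence it is still 0 at
      \<open>t\<close>.\<close>
    define Z where "Z = {u \<in> {z..t}. \<forall>i\<in>UNIV. W u $ i = 0}"
    have "compact Z" unfolding Z_def by (rule compact_zeros) fact
    moreover have "z \<in> Z" using z that by (auto simp: Z_def)
    ultimately obtain q where q: "q \<in> Z" "\<And>u. u \<in> Z \<Longrightarrow> u \<le> q"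
      using compact_attains_sup by (metis empty_iff)
    then have q': "z \<le> q" "q \<le> t" "W q = 0" by (auto simp: Z_def vec_eq_iff)
    have "decay q t"
    proof (rule decay_limit_left)
      fix u assume u: "q < u" "u \<le> t"
      have "W v \<noteq> 0" if "v \<in> {u..t}" for v
        using q(2)[of v] q' u that by (auto simp: Z_def)
      with u z q' show "decay u t" by (intro decay_nonzero) auto
    qed (use z q' in auto)
    then have "h \<bullet> W t \<le> \<epsilon> * (q - t)" by (simp add: decay_def q' algebra_simps)
    also have "\<dots> \<le> 0" using \<open>0 < \<epsilon>\<close> q' by (simp add: mult_nonneg_nonpos)
    finally show ?thesis using V_zero z that by auto
  qed
  with z show ?thesis by blast
qed

end

section \<open>From the optimal value to stability\<close>

lemma skorohod_stable_if_inner_feasible: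
  assumes "inner_feasible R \<theta> B h a \<epsilon> \<eta>" "0 < \<epsilon>"
  shows "skorohod_stable R \<theta>"
  unfolding skorohod_stable_def
proof (intro allI impI)
  fix Y W assume sol: "skorohod_solution R \<theta> Y W"
  \<comment> \<open>A partition is determined by \<open>b\<close>; the condition
    \<open>b \<noteq> UNIV\<close> says that its other block is nonempty.\<close>
  have part: "(\<Sum>i\<in>-b. h $ i * \<theta> $ i) - (\<Sum>i\<in>b. a b $ i * \<theta> $ i) \<le> - \<epsilon> \<and>
    (\<forall>l\<in>b. (\<Sum>i\<in>-b. h $ i * R $ i $ l) \<le> (\<Sum>i\<in>b. a b $ i * R $ i $ l))" if "b \<noteq> UNIV" for b
  proof -
    have "- b \<union> b = UNIV \<and> - b \<inter> b = {} \<and> - b \<noteq> {}" using that by auto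
    with assms(1) show ?thesis unfolding inner_feasible_def by blast
  qed
  have "0 < h $ i" for i
    using assms(1) unfolding inner_feasible_def by (meson less_le_trans zero_less_one)
  then show "\<exists>T\<ge>0. \<forall>t\<ge>T. W t = 0"
    by (intro eventually_zero[OF sol, of h a \<epsilon>]) (use part \<open>0 < \<epsilon>\<close> in auto)
qed

text \<open>A positive supremum already provides a feasible point with positive
  \<open>\<epsilon>\<close>; attainment of the maximum is not at issue.\<close>

lemma skorohod_stable_if_inner_value_pos:
  assumes "0 < inner_value R \<theta> B"
  shows "skorohod_stable R \<theta>"
proof -
  from assms obtain h a \<epsilon> \<eta> where "inner_feasible R \<theta> B h a \<epsilon> \<eta>" "0 < ereal \<epsilon>"
    unfolding inner_value_def less_Sup_iff by blast
  then show ?thesis by (intro skorohod_stable_if_inner_feasible) auto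
qed

theorem lemma1:
  fixes C :: "real ^ 'k ^ 'j" and M P :: "real ^ 'k ^ 'k" and \<alpha> :: "real ^ 'k"
  assumes "network_primitives C M P \<alpha>"
    and "\<And>\<Delta>. ratio_matrix C M \<Delta> \<Longrightarrow> invertible (C ** M ** Q_mat P ** \<Delta>)"
  shows "\<exists>B0>0. \<forall>B\<ge>B0.
           (\<forall>j. load C M P \<alpha> $ j < 1) \<and> minmax_value C M P \<alpha> B > 0 \<longrightarrow>
           robustly_queue_ratio_stable C M P \<alpha>"
proof -
  have "robustly_queue_ratio_stable C M P \<alpha>" if pos: "minmax_value C M P \<alpha> B > 0" for B
    unfolding robustly_queue_ratio_stable_def
  proof (intro allI impI)
    fix \<Delta> assume "ratio_matrix C M \<Delta>"
    \<comment> \<open>The infimum over ratio matrices bounds the inner value of each of them from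
      below, which makes stability uniform over \<open>\<Delta>\<close>.\<close>
    then have "minmax_value C M P \<alpha> B
        \<le> inner_value (R_mat C M P \<Delta>) (theta_vec C M P \<alpha> \<Delta>) B"
      unfolding minmax_value_def by (intro INF_lower) simp
    with pos show "skorohod_stable (R_mat C M P \<Delta>) (theta_vec C M P \<alpha> \<Delta>)"
      using skorohod_stable_if_inner_value_pos order_less_le_trans by blast
  qed
  \<comment> \<open>The implication has been shown for arbitrary \<open>B\<close>, so 1 can serve as
    the threshold.\<close>
  then show ?thesis by (intro exI[of _ 1]) auto
qed

end
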